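(* Let $\alpha > 1$ and let $\mu$ be a fixed probability law on $\mathbb{R}$ with finite absolute moment of order $2\alpha$. For all integers $m,n\ge 1$, let $A = (A_{ij})_{1 \le i \le m, 1 \le j \le n}$ be a random matrix whose entries are i.i.d. with law $\mu$. As $m$ and $n$ tend to infinity with $m = O(n)$, we have $$n^{-1} \|A\|_{\ell^\infty \to \ell^\infty} \to \mathbb{E}[|A_{11}|] \quad \text{in probability}.$$ That is, for every $C<+\infty$ and $\varepsilon,\delta>0$ there exists $N$ such that for all $m,n \ge N$ with $m \le C n$, $$\mathbb{P}\big[\,\big|n^{-1}\|A\|_{\ell^\infty\to\ell^\infty} - \mathbb{E}[|A_{11}|]\big| \ge \varepsilon\,\big] \le \delta.$$
   Context: For a matrix $A = (A_{ij}) \in \mathbb{R}^{m\times n}$, the $\ell^\infty\to\ell^\infty$ operator norm is $$\|A\|_{\ell^\infty \to \ell^\infty} := \sup_{|x|_\infty \le 1} |Ax|_\infty = \max_{1 \le i \le m} \sum_{j = 1}^n |A_{ij}|,$$ where $|x|_\infty = \max_j |x_j|$. *)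

theory Defs
  imports "HOL-Probability.Probability" "Jordan_Normal_Form.Matrix"
begin

text \<open>Rows, columns and coordinates are indexed from \<open>0\<close>. The maximum is unspecified for vectors
  of dimension \<open>0\<close>.\<close>

definition linf_norm_vec :: "real vec \<Rightarrow> real" where
  "linf_norm_vec v = (MAX i\<in>{..<dim_vec v}. \<bar>v $ i\<bar>)"

text \<open>A supremum in the reals; for matrices without empty dimension the set is nonempty and
  bounded above, so it is the true supremum.\<close>

definition linf_opnorm :: "real mat \<Rightarrow> real" where
  "linf_opnorm A =
     (SUP x\<in>{x \<in> carrier_vec (dim_col A). linf_norm_vec x \<le> 1}. linf_norm_vec (A *\<^sub>v x))"

text \<open>\<open>A\<close> is a random \<open>m \<times> n\<close> matrix on the probability space \<open>M\<close>
  with i.i.d. entries of law \<open>\<mu>\<close>. Measurability of the entries is part of \<open>indep_vars\<close>.\<close>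

definition iid_random_matrix ::
  "'a measure \<Rightarrow> real measure \<Rightarrow> nat \<Rightarrow> nat \<Rightarrow> ('a \<Rightarrow> real mat) \<Rightarrow> bool" where
  "iid_random_matrix M \<mu> m n A \<longleftrightarrow>
     prob_space M \<and>
     (\<forall>\<omega>\<in>space M. A \<omega> \<in> carrier_mat m n) \<and>
     prob_space.indep_vars M (\<lambda>_. borel) (\<lambda>ij \<omega>. A \<omega> $$ ij) ({..<m} \<times> {..<n}) \<and>
     (\<forall>i<m. \<forall>j<n. distr M borel (\<lambda>\<omega>. A \<omega> $$ (i, j)) = \<mu>)"

end

theory Submission
  imports Defs "HOL-Real_Asymp.Real_Asymp"
begin

text \<open>The operator norm is the largest row sum of absolute values, so a union bound over the
  \<open>m = O(n)\<close> rows leaves a single estimate: the empirical mean of \<open>n\<close> i.i.d. copies of \<open>\<bar>A\<^sub>1\<^sub>1\<bar>\<close>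
  deviates by \<open>\<epsilon>\<close> with probability \<open>o(1/n)\<close>. To get it, clamp the variable to \<open>[-K, K]\<close>. The clamped
  part deviates with exponentially small probability (Hoeffding), while Chebyshev's inequality
  bounds \<open>n\<close> times the deviation probability of the remainder by a multiple of its second moment,
  which vanishes as \<open>K \<rightarrow> \<infinity>\<close>.\<close>

section \<open>The operator norm as the largest absolute row sum\<close>

lemma linf_norm_vec_le_iff:
  assumes "dim_vec v > 0"
  shows "linf_norm_vec v \<le> c \<longleftrightarrow> (\<forall>i<dim_vec v. \<bar>v $ i\<bar> \<le> c)"
  using assms unfolding linf_norm_vec_def by (subst Max_le_iff) auto

lemma linf_norm_vec_ge:
  assumes "i < dim_vec v"
  shows "\<bar>v $ i\<bar> \<le> linf_norm_vec v"
  using assms unfolding linf_norm_vec_def by (intro Max_ge) auto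

text \<open>On the unit ball the triangle inequality bounds every coordinate of the image by its row
  sum. A row with the largest sum reaches this bound at some vector of the ball, so the supremum is
  a maximum. Both dimensions are positive because \<open>linf_norm_vec\<close> is unspecified on
  empty vectors.\<close>

lemma linf_opnorm_eq_Max_row_sum:
  assumes A: "A \<in> carrier_mat m n" and pos: "m > 0" "n > 0"
  shows "linf_opnorm A = (MAX i\<in>{..<m}. \<Sum>j<n. \<bar>A $$ (i, j)\<bar>)"
proof -
  define B where "B = {x \<in> carrier_vec n. linf_norm_vec x \<le> 1}"
  define r where "r i = (\<Sum>j<n. \<bar>A $$ (i, j)\<bar>)" for i
  have entry: "(A *\<^sub>v x) $ i = (\<Sum>j<n. A $$ (i, j) * x $ j)"
    if "x \<in> carrier_vec n" "i < m" for x i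
    using that A by (auto simp: scalar_prod_def lessThan_atLeast0 intro!: sum.cong)
  have r_le: "r i \<le> Max (r ` {..<m})" if "i < m" for i
    using that by (intro Max_ge) auto
  have upper: "linf_norm_vec (A *\<^sub>v x) \<le> Max (r ` {..<m})" if x: "x \<in> B" for x
  proof -
    have x': "x \<in> carrier_vec n" "\<forall>j<n. \<bar>x $ j\<bar> \<le> 1"
      using x pos by (auto simp: B_def linf_norm_vec_le_iff)
    have "\<bar>(A *\<^sub>v x) $ i\<bar> \<le> Max (r ` {..<m})" if i: "i < m" for i
    proof -
      have "\<bar>(A *\<^sub>v x) $ i\<bar> \<le> (\<Sum>j<n. \<bar>A $$ (i, j) * x $ j\<bar>)"
        unfolding entry[OF x'(1) i] by (rule sum_abs)
      also have "\<dots> \<le> r i"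
        unfolding r_def using x'(2) by (intro sum_mono) (simp add: abs_mult mult_left_le)
      finally show ?thesis
        using r_le[OF i] by simp
    qed
    then show ?thesis
      using A pos by (subst linf_norm_vec_le_iff) auto
  qed
  have "Max (r ` {..<m}) \<in> r ` {..<m}"
    using pos by (intro Max_in) auto
  then obtain i where i: "i < m" "Max (r ` {..<m}) = r i"
    by auto
  \<comment> \<open>The row sum is attained at the sign vector of the row.\<close>
  define x where "x = vec n (\<lambda>j. sgn (A $$ (i, j)))"
  have x: "x \<in> B"
    using pos by (auto simp: B_def x_def linf_norm_vec_le_iff abs_sgn_eq)
  have "r i = (A *\<^sub>v x) $ i"
    using x i by (subst entry) (auto simp: B_def r_def x_def abs_sgn intro!: sum.cong)
  also have "\<dots> \<le> linf_norm_vec (A *\<^sub>v x)"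
    using linf_norm_vec_ge[of i "A *\<^sub>v x"] A i by simp
  finally have "Max (r ` {..<m}) \<le> linf_norm_vec (A *\<^sub>v x)"
    using i by simp
  then have "(SUP x\<in>B. linf_norm_vec (A *\<^sub>v x)) = Max (r ` {..<m})"
    using x upper by (intro cSup_eq_maximum) (auto intro: antisym)
  then show ?thesis
    using A by (simp add: linf_opnorm_def B_def r_def)
qed

section \<open>Second moments of sums of independent variables\<close>

lemma (in prob_space) indep_vars_expectation_mult:
  fixes X :: "'i \<Rightarrow> 'a \<Rightarrow> real"
  assumes "indep_vars (\<lambda>_. borel) X I" "i \<in> I" "j \<in> I" "i \<noteq> j"
    and "integrable M (X i)" "integrable M (X j)"
  shows "integrable M (\<lambda>\<omega>. X i \<omega> * X j \<omega>)"
    and "expectation (\<lambda>\<omega>. X i \<omega> * X j \<omega>) = expectation (X i) * expectation (X j)"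
proof -
  have "indep_vars (\<lambda>_. borel) X {i, j}"
    using assms by (auto intro: indep_vars_subset)
  then show "integrable M (\<lambda>\<omega>. X i \<omega> * X j \<omega>)"
    and "expectation (\<lambda>\<omega>. X i \<omega> * X j \<omega>) = expectation (X i) * expectation (X j)"
    using indep_vars_lebesgue_integral[of "{i, j}" X] indep_vars_integrable[of "{i, j}" X] assms
    by auto
qed

text \<open>Expanding the square leaves diagonal terms, integrable by assumption, and products of
  two distinct variables, integrable by independence. This is the integrability premise of
  Chebyshev's inequality for the sum.\<close>

lemma (in prob_space) square_sum_integrable:
  fixes X :: "'i \<Rightarrow> 'a \<Rightarrow> real"
  assumes "finite I" "indep_vars (\<lambda>_. borel) X I"
    and "\<And>i. i \<in> I \<Longrightarrow> integrable M (\<lambda>\<omega>. (X i \<omega>)\<^sup>2)"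
  shows "integrable M (\<lambda>\<omega>. (\<Sum>i\<in>I. X i \<omega>)\<^sup>2)"
proof -
  have rv: "random_variable borel (X i)" if "i \<in> I" for i
    using assms(2) that by (auto simp: indep_vars_def)
  have intX: "integrable M (X i)" if "i \<in> I" for i
    using square_integrable_imp_integrable[OF rv assms(3)] that by blast
  have "integrable M (\<lambda>\<omega>. X i \<omega> * X j \<omega>)" if "i \<in> I" "j \<in> I" for i j
  proof (cases "i = j")
    case True
    then show ?thesis using assms(3)[of i] that by (simp add: power2_eq_square)
  next
    case False
    then show ?thesis
      using indep_vars_expectation_mult(1)[OF assms(2)] that intX by blast
  qed
  then show ?thesis
    by (simp add: power2_eq_square sum_product)
qed

text \<open>After centring, the square of the sum expands into products of mean-zero variables. By
  independence the cross terms have expectation 0, and the diagonal terms are the variances.\<close>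

lemma (in prob_space) variance_sum_indep:
  fixes X :: "'i \<Rightarrow> 'a \<Rightarrow> real"
  assumes "finite I" "indep_vars (\<lambda>_. borel) X I"
    and "\<And>i. i \<in> I \<Longrightarrow> integrable M (\<lambda>\<omega>. (X i \<omega>)\<^sup>2)"
  shows "variance (\<lambda>\<omega>. \<Sum>i\<in>I. X i \<omega>) = (\<Sum>i\<in>I. variance (X i))"
proof -
  define Y where "Y i \<omega> = X i \<omega> - expectation (X i)" for i \<omega>
  have rv: "random_variable borel (X i)" if "i \<in> I" for i
    using assms(2) that by (auto simp: indep_vars_def)
  have intX: "integrable M (X i)" if "i \<in> I" for i
    using square_integrable_imp_integrable[OF rv assms(3)] that by blast
  have intY: "integrable M (Y i)" and EY: "expectation (Y i) = 0" if "i \<in> I" for i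
    using intX[OF that] by (auto simp: Y_def[abs_def] prob_space)
  have intYY: "integrable M (\<lambda>\<omega>. Y i \<omega> * Y i \<omega>)" if "i \<in> I" for i
    using intX[OF that] assms(3)[OF that]
    by (simp add: Y_def power2_eq_square[symmetric] power2_diff)
  have indepY: "indep_vars (\<lambda>_. borel) Y I"
    unfolding Y_def[abs_def] by (rule indep_vars_compose2[OF assms(2)]) auto
  have int: "integrable M (\<lambda>\<omega>. Y i \<omega> * Y j \<omega>)"
    and E: "expectation (\<lambda>\<omega>. Y i \<omega> * Y j \<omega>) = (if j = i then variance (X i) else 0)"
    if "i \<in> I" "j \<in> I" for i j
    using indep_vars_expectation_mult[OF indepY that] intY[of i] intY[of j] intYY[of i] EY[of i] that
    by (cases "i = j"; simp add: Y_def[symmetric] power2_eq_square)+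
  have "(\<Sum>i\<in>I. X i \<omega>) - expectation (\<lambda>\<omega>. \<Sum>i\<in>I. X i \<omega>) = (\<Sum>i\<in>I. Y i \<omega>)" for \<omega>
    using intX by (simp add: Y_def sum_subtractf)
  then have "variance (\<lambda>\<omega>. \<Sum>i\<in>I. X i \<omega>) = expectation (\<lambda>\<omega>. \<Sum>i\<in>I. \<Sum>j\<in>I. Y i \<omega> * Y j \<omega>)"
    by (simp add: power2_eq_square sum_product)
  also have "\<dots> = (\<Sum>i\<in>I. \<Sum>j\<in>I. expectation (\<lambda>\<omega>. Y i \<omega> * Y j \<omega>))"
    using int by simp
  also have "\<dots> = (\<Sum>i\<in>I. variance (X i))"
    using assms(1) by (simp add: E)
  finally show ?thesis .
qed

section \<open>Truncation and the tail of an empirical mean\<close>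

definition cutoff :: "real \<Rightarrow> real \<Rightarrow> real" where
  "cutoff K x = max (- K) (min K x)"

lemma borel_measurable_cutoff [measurable]: "cutoff K \<in> borel_measurable borel"
  unfolding cutoff_def[abs_def] by measurable

lemma cutoff_bounded: "K \<ge> 0 \<Longrightarrow> cutoff K x \<in> {- K..K}"
  by (auto simp: cutoff_def)

lemma cutoff_remainder_bounded: "K \<ge> 0 \<Longrightarrow> \<bar>x - cutoff K x\<bar> \<le> \<bar>x\<bar>"
  by (auto simp: cutoff_def)

text \<open>Dominated convergence with majorant \<open>x\<^sup>2\<close>: for fixed \<open>x\<close>
  the remainder is exactly 0 once \<open>k\<close> is at least the absolute value of
  \<open>x\<close>.\<close>

lemma cutoff_remainder_second_moment_tendsto_0:
  assumes "sets \<mu> = sets borel" "integrable \<mu> (\<lambda>x. x\<^sup>2)"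
  shows "(\<lambda>k. \<integral>x. (x - cutoff (real k) x)\<^sup>2 \<partial>\<mu>) \<longlonglongrightarrow> 0"
proof -
  note [measurable_cong] = assms(1)
  have "(\<lambda>k. \<integral>x. (x - cutoff (real k) x)\<^sup>2 \<partial>\<mu>) \<longlonglongrightarrow> (\<integral>x. 0 \<partial>\<mu>)"
  proof (rule integral_dominated_convergence[OF _ _ assms(2)])
    show "AE x in \<mu>. (\<lambda>k. (x - cutoff (real k) x)\<^sup>2) \<longlonglongrightarrow> 0"
    proof (rule AE_I2)
      fix x :: real
      have "\<forall>\<^sub>F k in sequentially. (x - cutoff (real k) x)\<^sup>2 = 0"
        using eventually_ge_at_top[of "nat \<lceil>\<bar>x\<bar>\<rceil>"]
        by eventually_elim (auto simp: cutoff_def nat_le_iff ceiling_le_iff)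
      then show "(\<lambda>k. (x - cutoff (real k) x)\<^sup>2) \<longlonglongrightarrow> 0"
        by (rule tendsto_eventually)
    qed
    show "AE x in \<mu>. norm ((x - cutoff (real k) x)\<^sup>2) \<le> x\<^sup>2" for k
      using cutoff_remainder_bounded by (intro AE_I2) (simp add: abs_le_square_iff[symmetric])
  qed measurable
  then show ?thesis by simp
qed

text \<open>The first term comes from Hoeffding for the clamped part, the second from Chebyshev for
  the remainder. The level \<open>K\<close> stays free: after multiplication by \<open>n\<close>,
  the first term still vanishes as \<open>n\<close> grows with \<open>K\<close> fixed, while the
  second no longer depends on \<open>n\<close> and is made small by the choice of
  \<open>K\<close>.\<close>

lemma (in prob_space) iid_mean_tail_bound:
  fixes X :: "'i \<Rightarrow> 'a \<Rightarrow> real"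
  assumes fin: "finite I" and ne: "I \<noteq> {}" and indep: "indep_vars (\<lambda>_. borel) X I"
    and law: "\<And>i. i \<in> I \<Longrightarrow> distr M borel (X i) = \<mu>"
    and sq: "integrable \<mu> (\<lambda>x. x\<^sup>2)" and pos: "\<epsilon> > 0" "K > 0"
  defines "n \<equiv> real (card I)"
  shows "prob {\<omega> \<in> space M. \<bar>(\<Sum>i\<in>I. X i \<omega>) / n - (\<integral>x. x \<partial>\<mu>)\<bar> \<ge> \<epsilon>}
    \<le> 2 * exp (- (n * \<epsilon>\<^sup>2 / (8 * K\<^sup>2))) + 4 * (\<integral>x. (x - cutoff K x)\<^sup>2 \<partial>\<mu>) / (n * \<epsilon>\<^sup>2)"
proof -
  define Y where "Y i \<omega> = cutoff K (X i \<omega>)" for i \<omega>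
  define Z where "Z i \<omega> = X i \<omega> - cutoff K (X i \<omega>)" for i \<omega>
  define y z s where "y = (\<integral>x. cutoff K x \<partial>\<mu>)" and "z = (\<integral>x. x - cutoff K x \<partial>\<mu>)"
    and "s = (\<integral>x. (x - cutoff K x)\<^sup>2 \<partial>\<mu>)"
  have n: "n > 0"
    using fin ne by (simp add: n_def card_gt_0_iff)
  have rv [measurable]: "random_variable borel (X i)" if "i \<in> I" for i
    using indep that by (auto simp: indep_vars_def)
  obtain i0 where i0: "i0 \<in> I" using ne by auto
  have sets_\<mu> [measurable_cong]: "sets \<mu> = sets borel"
    using law[OF i0] by auto
  interpret \<mu>: prob_space \<mu>
    using law[OF i0] prob_space_distr[OF rv[OF i0]] by simp
  \<comment> \<open>Change of variables under the common law: the moments of \<open>Y i\<close> and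
    \<open>Z i\<close> become integrals that depend on \<open>\<mu>\<close> and \<open>K\<close>
    alone.\<close>
  have transfer_int: "integrable M (\<lambda>\<omega>. f (X i \<omega>)) \<longleftrightarrow> integrable \<mu> f"
    and transfer: "expectation (\<lambda>\<omega>. f (X i \<omega>)) = (\<integral>x. f x \<partial>\<mu>)"
    if "i \<in> I" "f \<in> borel_measurable borel" for i and f :: "real \<Rightarrow> real"
    using law[OF that(1)] that integrable_distr_eq[of "X i" M borel f]
      integral_distr[of "X i" M borel f] by auto
  have int_id: "integrable \<mu> (\<lambda>x. x)"
    by (rule \<mu>.square_integrable_imp_integrable[OF _ sq]) measurable
  have int_cutoff: "integrable \<mu> (cutoff K)"
    using cutoff_bounded[of K] pos
    by (intro \<mu>.integrable_const_bound[where B = K]) (auto simp: abs_le_iff minus_le_iff)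
  have int_sq: "integrable \<mu> (\<lambda>x. (x - cutoff K x)\<^sup>2)"
    using cutoff_remainder_bounded[of K] pos
    by (intro Bochner_Integration.integrable_bound[OF sq])
      (auto simp: abs_le_square_iff[symmetric])
  \<comment> \<open>Clamping may shift the mean, so each part is compared with its own mean; the
    shifts cancel in the sum.\<close>
  have mean: "(\<integral>x. x \<partial>\<mu>) = y + z"
    using int_id int_cutoff by (simp add: y_def z_def)

  have indepY: "indep_vars (\<lambda>_. borel) Y I"
    unfolding Y_def[abs_def] by (rule indep_vars_compose2[OF indep]) measurable
  have indepZ: "indep_vars (\<lambda>_. borel) Z I"
    unfolding Z_def[abs_def] by (rule indep_vars_compose2[OF indep]) measurable
  have [measurable]: "random_variable borel (Y i)" "random_variable borel (Z i)" if "i \<in> I" for i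
    using that by (auto simp: Y_def[abs_def] Z_def[abs_def])

  interpret Y: Hoeffding_ineq M I Y "\<lambda>_. - K" "\<lambda>_. K" "\<Sum>i\<in>I. expectation (Y i)"
    using fin indepY cutoff_bounded[of K] pos
    by unfold_locales (auto simp: Y_def)
  have sumY: "(\<Sum>i\<in>I. expectation (Y i)) = n * y"
    using transfer[of _ "cutoff K"] by (simp add: Y_def[abs_def] y_def n_def)
  have "prob {\<omega> \<in> space M. \<bar>(\<Sum>i\<in>I. Y i \<omega>) - n * y\<bar> \<ge> n * \<epsilon> / 2}
    \<le> 2 * exp (- 2 * (n * \<epsilon> / 2)\<^sup>2 / (\<Sum>i\<in>I. (K - - K)\<^sup>2))"
    using Y.Hoeffding_ineq_abs_ge[of "n * \<epsilon> / 2"] pos n by (simp add: sumY flip: n_def)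
  \<comment> \<open>Each clamped variable ranges over an interval of length \<open>2 * K\<close>, so
    the denominator is \<open>4 * n * K\<^sup>2\<close>; halving the threshold supplies the other
    factor 2 in the constant 8.\<close>
  also have "- 2 * (n * \<epsilon> / 2)\<^sup>2 / (\<Sum>i\<in>I. (K - - K)\<^sup>2) = - (n * \<epsilon>\<^sup>2 / (8 * K\<^sup>2))"
    using n pos by (simp add: power2_eq_square field_simps flip: n_def)
  finally have boundY: "prob {\<omega> \<in> space M. \<bar>(\<Sum>i\<in>I. Y i \<omega>) - n * y\<bar> \<ge> n * \<epsilon> / 2}
    \<le> 2 * exp (- (n * \<epsilon>\<^sup>2 / (8 * K\<^sup>2)))" .

  have intZ: "integrable M (\<lambda>\<omega>. (Z i \<omega>)\<^sup>2)" "integrable M (Z i)" if "i \<in> I" for i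
    using that int_sq Bochner_Integration.integrable_diff[OF int_id int_cutoff] transfer_int[of i "\<lambda>x. (x - cutoff K x)\<^sup>2"]
      transfer_int[of i "\<lambda>x. x - cutoff K x"]
    by (simp_all add: Z_def[abs_def])
  have sumZ: "expectation (\<lambda>\<omega>. \<Sum>i\<in>I. Z i \<omega>) = n * z"
    using intZ(2) transfer[of _ "\<lambda>x. x - cutoff K x"]
    by (simp add: Z_def[abs_def] z_def n_def)
  \<comment> \<open>The variance is the second moment minus the squared mean, hence at most the
    second moment.\<close>
  have varZ: "variance (Z i) \<le> s" if "i \<in> I" for i
    using that intZ[OF that] transfer[of i "\<lambda>x. (x - cutoff K x)\<^sup>2"]
    by (subst variance_eq) (auto simp: Z_def[abs_def] s_def)
  have "prob {\<omega> \<in> space M. \<bar>(\<Sum>i\<in>I. Z i \<omega>) - n * z\<bar> \<ge> n * \<epsilon> / 2}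
    \<le> variance (\<lambda>\<omega>. \<Sum>i\<in>I. Z i \<omega>) / (n * \<epsilon> / 2)\<^sup>2"
    unfolding sumZ[symmetric] using pos n
    by (intro Chebyshev_inequality square_sum_integrable fin indepZ intZ) auto
  also have "variance (\<lambda>\<omega>. \<Sum>i\<in>I. Z i \<omega>) = (\<Sum>i\<in>I. variance (Z i))"
    by (intro variance_sum_indep fin indepZ intZ)
  also have "(\<Sum>i\<in>I. variance (Z i)) / (n * \<epsilon> / 2)\<^sup>2 \<le> (n * s) / (n * \<epsilon> / 2)\<^sup>2"
    unfolding n_def using varZ by (intro divide_right_mono sum_bounded_above) auto
  also have "\<dots> = 4 * s / (n * \<epsilon>\<^sup>2)"
    using n by (simp add: power2_eq_square field_simps)
  finally have boundZ: "prob {\<omega> \<in> space M. \<bar>(\<Sum>i\<in>I. Z i \<omega>) - n * z\<bar> \<ge> n * \<epsilon> / 2}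
    \<le> 4 * s / (n * \<epsilon>\<^sup>2)" .

  \<comment> \<open>If the two deviations add up to at least \<open>n * \<epsilon>\<close>, one of
    them is at least half of that.\<close>
  have "{\<omega> \<in> space M. \<bar>(\<Sum>i\<in>I. X i \<omega>) / n - (\<integral>x. x \<partial>\<mu>)\<bar> \<ge> \<epsilon>}
    \<subseteq> {\<omega> \<in> space M. \<bar>(\<Sum>i\<in>I. Y i \<omega>) - n * y\<bar> \<ge> n * \<epsilon> / 2}
      \<union> {\<omega> \<in> space M. \<bar>(\<Sum>i\<in>I. Z i \<omega>) - n * z\<bar> \<ge> n * \<epsilon> / 2}" (is "?E \<subseteq> ?EY \<union> ?EZ")
  proof (intro subsetI)
    fix \<omega> assume \<omega>: "\<omega> \<in> ?E"
    have split: "(\<Sum>i\<in>I. X i \<omega>) = (\<Sum>i\<in>I. Y i \<omega>) + (\<Sum>i\<in>I. Z i \<omega>)"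
      by (simp add: Y_def Z_def flip: sum.distrib)
    have "n * \<epsilon> \<le> n * \<bar>(\<Sum>i\<in>I. X i \<omega>) / n - (\<integral>x. x \<partial>\<mu>)\<bar>"
      using \<omega> n by simp
    also have "\<dots> = \<bar>n * ((\<Sum>i\<in>I. X i \<omega>) / n - (\<integral>x. x \<partial>\<mu>))\<bar>"
      using n by (simp add: abs_mult)
    also have "n * ((\<Sum>i\<in>I. X i \<omega>) / n - (\<integral>x. x \<partial>\<mu>))
      = ((\<Sum>i\<in>I. Y i \<omega>) - n * y) + ((\<Sum>i\<in>I. Z i \<omega>) - n * z)"
      using n by (simp add: mean split field_simps)
    also have "\<bar>\<dots>\<bar> \<le> \<bar>(\<Sum>i\<in>I. Y i \<omega>) - n * y\<bar> + \<bar>(\<Sum>i\<in>I. Z i \<omega>) - n * z\<bar>"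
      by (rule abs_triangle_ineq)
    finally show "\<omega> \<in> ?EY \<union> ?EZ"
      using \<omega> by auto
  qed
  then have "prob ?E \<le> prob (?EY \<union> ?EZ)"
    by (intro finite_measure_mono) auto
  also have "\<dots> \<le> prob ?EY + prob ?EZ"
    by (intro measure_Un_le) auto
  finally show ?thesis
    using boundY boundZ by (simp add: s_def)
qed

text \<open>The preceding bound involves only \<open>\<mu>\<close> and the number of variables, so
  one \<open>N\<close> serves all probability spaces and all families. This uniformity matters
  because every pair of dimensions has its own space. The factor \<open>card I\<close> prepares for
  a union bound over a number of rows proportional to the row length.\<close>

lemma iid_mean_tail_uniform:
  fixes \<mu> :: "real measure"
  assumes "sets \<mu> = sets borel" "integrable \<mu> (\<lambda>x. x\<^sup>2)" "\<epsilon> > 0" "\<delta> > 0"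
  obtains N :: nat where
    "\<And>(M :: 'a measure) (X :: 'i \<Rightarrow> 'a \<Rightarrow> real) I.
      prob_space M \<Longrightarrow> finite I \<Longrightarrow> I \<noteq> {} \<Longrightarrow> card I \<ge> N \<Longrightarrow>
      prob_space.indep_vars M (\<lambda>_. borel) X I \<Longrightarrow> (\<And>i. i \<in> I \<Longrightarrow> distr M borel (X i) = \<mu>) \<Longrightarrow>
      real (card I) * measure M {\<omega> \<in> space M.
        \<bar>(\<Sum>i\<in>I. X i \<omega>) / real (card I) - (\<integral>x. x \<partial>\<mu>)\<bar> \<ge> \<epsilon>} \<le> \<delta>"
proof -
  define s where "s k = (\<integral>x. (x - cutoff (real k) x)\<^sup>2 \<partial>\<mu>)" for k :: nat
  \<comment> \<open>The clamping level is fixed first, before \<open>N\<close>: it brings the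
    Chebyshev term, already multiplied by \<open>n\<close>, below half of
    \<open>\<delta>\<close>.\<close>
  have "(\<lambda>k. 4 * s k / \<epsilon>\<^sup>2) \<longlonglongrightarrow> 4 * 0 / \<epsilon>\<^sup>2"
    unfolding s_def by (intro tendsto_intros cutoff_remainder_second_moment_tendsto_0 assms)
      (use assms in auto)
  then have "\<forall>\<^sub>F k in sequentially. 4 * s k / \<epsilon>\<^sup>2 < \<delta> / 2"
    by (rule order_tendstoD(2)) (use assms in simp)
  then have "\<forall>\<^sub>F k in sequentially. 4 * s k / \<epsilon>\<^sup>2 < \<delta> / 2 \<and> k > 0"
    using eventually_gt_at_top by (rule eventually_conj)
  then obtain k where k: "4 * s k / \<epsilon>\<^sup>2 < \<delta> / 2" "k > 0"
    by (auto dest: eventually_happens)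
  define c where "c = \<epsilon>\<^sup>2 / (8 * (real k)\<^sup>2)"
  have "c > 0"
    using assms k by (simp add: c_def)
  \<comment> \<open>With \<open>k\<close> fixed the rate \<open>c\<close> is a positive constant, so
    the exponential beats the linear factor.\<close>
  then have "((\<lambda>n. 2 * real n * exp (- (real n * c))) \<longlonglongrightarrow> 0)"
    by real_asymp
  then have "\<forall>\<^sub>F n in sequentially. 2 * real n * exp (- (real n * c)) < \<delta> / 2"
    using assms by (auto dest!: order_tendstoD(2)[where a = "\<delta> / 2"])
  then obtain N where N: "2 * real n * exp (- (real n * c)) < \<delta> / 2" if "n \<ge> N" for n
    by (auto simp: eventually_at_top_linorder)
  show ?thesis
  proof (rule that[of N])
    fix M :: "'a measure" and X :: "'i \<Rightarrow> 'a \<Rightarrow> real" and I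
    assume hyps: "prob_space M" "finite I" "I \<noteq> {}" "card I \<ge> N"
      "prob_space.indep_vars M (\<lambda>_. borel) X I" "\<And>i. i \<in> I \<Longrightarrow> distr M borel (X i) = \<mu>"
    interpret prob_space M by fact
    define n where "n = card I"
    have n: "n > 0" "n \<ge> N"
      using hyps by (auto simp: n_def card_gt_0_iff)
    have "real n * prob {\<omega> \<in> space M. \<bar>(\<Sum>i\<in>I. X i \<omega>) / real n - (\<integral>x. x \<partial>\<mu>)\<bar> \<ge> \<epsilon>}
      \<le> real n * (2 * exp (- (real n * \<epsilon>\<^sup>2 / (8 * (real k)\<^sup>2))) + 4 * s k / (real n * \<epsilon>\<^sup>2))"
      unfolding n_def s_def using hyps assms k
      by (intro mult_left_mono iid_mean_tail_bound) auto
    also have "\<dots> = 2 * real n * exp (- (real n * c)) + 4 * s k / \<epsilon>\<^sup>2"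
      using n by (simp add: c_def distrib_left)
    also have "\<dots> \<le> \<delta>"
      using N[OF n(2)] k(1) by simp
    finally show "real (card I) * prob {\<omega> \<in> space M.
        \<bar>(\<Sum>i\<in>I. X i \<omega>) / real (card I) - (\<integral>x. x \<partial>\<mu>)\<bar> \<ge> \<epsilon>} \<le> \<delta>"
      by (simp add: n_def)
  qed
qed

section \<open>From the moment condition and single rows to the whole matrix\<close>

lemma (in real_distribution) integrable_power2_of_powr:
  assumes "integrable M (\<lambda>x. \<bar>x\<bar> powr p)" "p \<ge> 2"
  shows "integrable M (\<lambda>x. x\<^sup>2)"
proof (rule Bochner_Integration.integrable_bound)
  show "integrable M (\<lambda>x. 1 + \<bar>x\<bar> powr p)"
    using assms by simp
  \<comment> \<open>The constant 1 covers the unit interval and the power covers the rest; 1 is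
    integrable because the measure is finite.\<close>
  have "x\<^sup>2 \<le> 1 + \<bar>x\<bar> powr p" for x :: real
  proof (cases "\<bar>x\<bar> \<le> 1")
    case True
    then have "x\<^sup>2 \<le> 1"
      by (simp add: abs_square_le_1)
    then show ?thesis
      by (simp add: add_increasing2)
  next
    case False
    then have "x\<^sup>2 = \<bar>x\<bar> powr 2"
      by simp
    also have "\<dots> \<le> \<bar>x\<bar> powr p"
      using False assms by (intro powr_mono) auto
    finally show ?thesis by simp
  qed
  then show "AE x in M. norm (x\<^sup>2) \<le> norm (1 + \<bar>x\<bar> powr p)"
    by (intro AE_I2) (simp add: abs_of_nonneg add_nonneg_nonneg)
qed simp

theorem proposition1p1:
  fixes \<alpha> :: real
    and \<mu> :: "real measure"
    and M :: "nat \<Rightarrow> nat \<Rightarrow> 'a measure"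
    and A :: "nat \<Rightarrow> nat \<Rightarrow> 'a \<Rightarrow> real mat"
  assumes "\<alpha> > 1"
    and "real_distribution \<mu>"
    and "integrable \<mu> (\<lambda>x. \<bar>x\<bar> powr (2 * \<alpha>))"
    and "\<And>m n. m \<ge> 1 \<Longrightarrow> n \<ge> 1 \<Longrightarrow> iid_random_matrix (M m n) \<mu> m n (A m n)"
  shows "\<forall>C \<epsilon> \<delta> :: real. \<epsilon> > 0 \<longrightarrow> \<delta> > 0 \<longrightarrow>
    (\<exists>N. \<forall>m\<ge>N. \<forall>n\<ge>N. real m \<le> C * real n \<longrightarrow>
      measure (M m n) {\<omega> \<in> space (M m n).
        \<bar>linf_opnorm (A m n \<omega>) / real n
          - prob_space.expectation (M m n) (\<lambda>\<omega>. \<bar>A m n \<omega> $$ (0, 0)\<bar>)\<bar> \<ge> \<epsilon>} \<le> \<delta>)"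
proof (intro allI impI)
  fix C \<epsilon> \<delta> :: real
  assume pos: "\<epsilon> > 0" "\<delta> > 0"
  interpret \<mu>: real_distribution \<mu> by fact
  \<comment> \<open>Row sums add absolute values, so the tail estimate is applied to the law of the
    absolute value of an entry. Its second moment is that of \<open>\<mu>\<close>, and its mean is
    the claimed limit.\<close>
  define \<nu> where "\<nu> = distr \<mu> borel abs"
  have sq: "integrable \<nu> (\<lambda>x. x\<^sup>2)"
    using \<mu>.integrable_power2_of_powr[OF assms(3)] assms(1)
    by (simp add: \<nu>_def integrable_distr_eq)
  have sets_\<nu>: "sets \<nu> = sets borel"
    by (simp add: \<nu>_def)
  \<comment> \<open>The denominator is positive for every real \<open>C\<close> and dominates
    \<open>m / n\<close>, so the row bounds will add up to at most \<open>\<delta>\<close>.\<close>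
  have pos': "\<delta> / (\<bar>C\<bar> + 1) > 0"
    using pos by (simp add: add_nonneg_pos)
  obtain N where N:
    "\<And>(M :: 'a measure) (X :: nat \<times> nat \<Rightarrow> 'a \<Rightarrow> real) I.
      prob_space M \<Longrightarrow> finite I \<Longrightarrow> I \<noteq> {} \<Longrightarrow> card I \<ge> N \<Longrightarrow>
      prob_space.indep_vars M (\<lambda>_. borel) X I \<Longrightarrow> (\<And>i. i \<in> I \<Longrightarrow> distr M borel (X i) = \<nu>) \<Longrightarrow>
      real (card I) * measure M {\<omega> \<in> space M.
        \<bar>(\<Sum>i\<in>I. X i \<omega>) / real (card I) - (\<integral>x. x \<partial>\<nu>)\<bar> \<ge> \<epsilon>} \<le> \<delta> / (\<bar>C\<bar> + 1)"
    using iid_mean_tail_uniform[OF sets_\<nu> sq pos(1) pos'] by blast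
  \<comment> \<open>The threshold \<open>max 1 N\<close> also excludes empty matrices, in case
    \<open>N\<close> is 0.\<close>
  have "measure (M m n) {\<omega> \<in> space (M m n). \<bar>linf_opnorm (A m n \<omega>) / real n
      - prob_space.expectation (M m n) (\<lambda>\<omega>. \<bar>A m n \<omega> $$ (0, 0)\<bar>)\<bar> \<ge> \<epsilon>} \<le> \<delta>"
    if mn: "m \<ge> max 1 N" "n \<ge> max 1 N" "real m \<le> C * real n" for m n
  proof -
    define P where "P = M m n"
    define X where "X ij \<omega> = A m n \<omega> $$ ij" for ij \<omega>
    have m: "m > 0" and n: "n > 0" "n \<ge> N"
      using mn by auto
    have iid: "iid_random_matrix P \<mu> m n (A m n)"
      unfolding P_def using assms(4) m n by simp
    interpret P: prob_space P
      using iid by (simp add: iid_random_matrix_def)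
    have carrier: "A m n \<omega> \<in> carrier_mat m n" if "\<omega> \<in> space P" for \<omega>
      using iid that by (simp add: iid_random_matrix_def)
    have indep: "P.indep_vars (\<lambda>_. borel) X ({..<m} \<times> {..<n})"
      using iid by (simp add: iid_random_matrix_def X_def[abs_def])
    have rv [measurable]: "X (i, j) \<in> borel_measurable P" if "i < m" "j < n" for i j
      using indep that by (auto simp: P.indep_vars_def)
    have law: "distr P borel (X (i, j)) = \<mu>" if "i < m" "j < n" for i j
      using iid that by (simp add: iid_random_matrix_def X_def[abs_def])
    have law_abs: "distr P borel (\<lambda>\<omega>. \<bar>X (i, j) \<omega>\<bar>) = \<nu>" if "i < m" "j < n" for i j
      unfolding \<nu>_def law[OF that, symmetric] using rv[OF that]
      by (subst distr_distr) (auto simp: comp_def)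
    have "P.expectation (\<lambda>\<omega>. \<bar>X (0, 0) \<omega>\<bar>) = (\<integral>x. x \<partial>\<nu>)"
      unfolding law_abs[OF m n(1), symmetric] using rv[OF m n(1)]
      by (subst integral_distr) auto
    then have mean: "P.expectation (\<lambda>\<omega>. \<bar>A m n \<omega> $$ (0, 0)\<bar>) = (\<integral>x. x \<partial>\<nu>)"
      by (simp add: X_def)
    define E where "E i = {\<omega> \<in> space P. \<bar>(\<Sum>j<n. \<bar>X (i, j) \<omega>\<bar>) / real n - (\<integral>x. x \<partial>\<nu>)\<bar> \<ge> \<epsilon>}" for i
    have E_meas: "E i \<in> sets P" if "i < m" for i
      unfolding E_def using that by measurable
    have row: "real n * P.prob (E i) \<le> \<delta> / (\<bar>C\<bar> + 1)" if i: "i < m" for i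
    proof -
      have "P.indep_vars (\<lambda>_. borel) (\<lambda>ij \<omega>. \<bar>X ij \<omega>\<bar>) ({i} \<times> {..<n})"
        by (rule P.indep_vars_compose2[OF P.indep_vars_subset[OF indep]]) (use i in auto)
      then have "real (card ({i} \<times> {..<n})) * P.prob {\<omega> \<in> space P.
          \<bar>(\<Sum>ij\<in>{i} \<times> {..<n}. \<bar>X ij \<omega>\<bar>) / real (card ({i} \<times> {..<n})) - (\<integral>x. x \<partial>\<nu>)\<bar> \<ge> \<epsilon>}
        \<le> \<delta> / (\<bar>C\<bar> + 1)"
        using n i law_abs by (intro N P.prob_space_axioms) (auto simp: card_cartesian_product)
      \<comment> \<open>Independence is indexed by pairs, so a row enters the tail estimate as a set
        of pairs and is turned back into a sum over columns here.\<close>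
      moreover have "(\<Sum>ij\<in>{i} \<times> {..<n}. \<bar>X ij \<omega>\<bar>) = (\<Sum>j<n. \<bar>X (i, j) \<omega>\<bar>)" for \<omega>
        using sum.cartesian_product[of "\<lambda>i j. \<bar>X (i, j) \<omega>\<bar>" "{..<n}" "{i}"]
        by (simp add: case_prod_beta)
      ultimately show ?thesis
        by (simp add: card_cartesian_product E_def)
    qed
    \<comment> \<open>The norm equals the sum of some row, so its deviation, upward or downward, is
      a deviation of that row. One inclusion thus handles both tails.\<close>
    have "{\<omega> \<in> space P. \<bar>linf_opnorm (A m n \<omega>) / real n - (\<integral>x. x \<partial>\<nu>)\<bar> \<ge> \<epsilon>} \<subseteq> (\<Union>i<m. E i)"
    proof
      fix \<omega> assume \<omega>: "\<omega> \<in> {\<omega> \<in> space P. \<bar>linf_opnorm (A m n \<omega>) / real n - (\<integral>x. x \<partial>\<nu>)\<bar> \<ge> \<epsilon>}"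
      have "(MAX i\<in>{..<m}. \<Sum>j<n. \<bar>A m n \<omega> $$ (i, j)\<bar>) \<in> (\<lambda>i. \<Sum>j<n. \<bar>A m n \<omega> $$ (i, j)\<bar>) ` {..<m}"
        using m by (intro Max_in) auto
      then obtain i where "i < m" "linf_opnorm (A m n \<omega>) = (\<Sum>j<n. \<bar>X (i, j) \<omega>\<bar>)"
        using linf_opnorm_eq_Max_row_sum[OF carrier m n(1)] \<omega> by (auto simp: X_def)
      then show "\<omega> \<in> (\<Union>i<m. E i)"
        using \<omega> by (auto simp: E_def)
    qed
    then have "P.prob {\<omega> \<in> space P. \<bar>linf_opnorm (A m n \<omega>) / real n - (\<integral>x. x \<partial>\<nu>)\<bar> \<ge> \<epsilon>}
      \<le> P.prob (\<Union>i<m. E i)"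
      using E_meas by (intro P.finite_measure_mono) auto
    also have "\<dots> \<le> (\<Sum>i<m. P.prob (E i))"
      using E_meas by (intro P.finite_measure_subadditive_finite) auto
    also have "\<dots> \<le> (\<Sum>i<m. \<delta> / (\<bar>C\<bar> + 1) / real n)"
      using row n by (intro sum_mono) (simp add: pos_le_divide_eq[where c = "real n"] mult.commute del: divide_divide_eq_left)
    also have "\<dots> = real m / real n * (\<delta> / (\<bar>C\<bar> + 1))"
      by simp
    also have "\<dots> \<le> (\<bar>C\<bar> + 1) * (\<delta> / (\<bar>C\<bar> + 1))"
    proof (intro mult_right_mono)
      have "real m / real n \<le> C"
        using mn(3) n by (simp add: pos_divide_le_eq)
      then show "real m / real n \<le> \<bar>C\<bar> + 1"
        by linarith
    qed (use pos' in simp)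
    also have "\<dots> = \<delta>"
      by (simp add: add_nonneg_eq_0_iff)
    finally show ?thesis
      unfolding P_def[symmetric] mean .
  qed
  then show "\<exists>N. \<forall>m\<ge>N. \<forall>n\<ge>N. real m \<le> C * real n \<longrightarrow>
      measure (M m n) {\<omega> \<in> space (M m n). \<bar>linf_opnorm (A m n \<omega>) / real n
        - prob_space.expectation (M m n) (\<lambda>\<omega>. \<bar>A m n \<omega> $$ (0, 0)\<bar>)\<bar> \<ge> \<epsilon>} \<le> \<delta>"
    by blast
qed

end
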